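(* Let $\Delta_3^rW=\Delta_3^r x_{i_1}^{s_1}x_{i_2}^{s_2}\cdots x_{i_h}^{s_h}$ be in Garside normal form, written in syllable form. Then it is a summit word if and only if one of the following holds: (0) $\Delta_3^rW$ is of the form $\Delta_3^{r}$ with $r$ even, or $\Delta_3^{r}x_i$ with $r$ odd and $i\in\{1,2\}$, or $\Delta_3^{r}x_{i_1}x_{i_2}$ with $r$ even; or (i) $h+1\equiv r\pmod 2$; or (ii) $s_j\ge 2$ for all $1\le j\le h$.
   Context: $\mathcal{B}_3=\langle x_1,x_2 : x_2x_1x_2=x_1x_2x_1\rangle$ is the 3-braid group. $\mathcal{MB}_3\subset\mathcal{B}_3$ is the monoid of positive elements (products of $x_1,x_2$). $\Delta_3=x_1x_2x_1$, and $\mathcal{MB}_3^+=\mathcal{MB}_3\setminus\Delta_3\mathcal{MB}_3$. Every element of $\mathcal{B}_3$ is uniquely $\Delta_3^rW$ with $r\in\mathbb{Z}$, $W\in\mathcal{MB}_3^+$ (Garside normal form). Syllable form of $W$: $W=x_{i_1}^{s_1}\cdots x_{i_h}^{s_h}$ with $h\ge0$, $i_j\in\{1,2\}$, $i_j\ne i_{j+1}$, $s_j\ge1$ ($h=0$ means $W=1$). For a conjugacy class $C$ of $\mathcal{B}_3$, $\exp(C)$ is the maximum (which exists, by Garside) of the integers $r$ such that $\Delta_3^rW\in C$ for some $W\in\mathcal{MB}_3^+$. The summit set is $SS(C)=\{\Delta_3^rW\in C : W\in\mathcal{MB}_3^+,\ r=\exp(C)\}$. An expression $\Delta_3^rW$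 in normal form is a summit word if it belongs to the summit set of its conjugacy class. *)

theory Defs
  imports "HOL-Algebra.Coset"
begin

datatype gen = X1 | X2

text \<open>A signed letter \<open>(k, True)\<close> stands for \<open>x\<^sub>k\<close>, and \<open>(k, False)\<close> for its formal inverse.
  Two words are identified when they represent the same element of the group
  \<open>\<langle>x\<^sub>1, x\<^sub>2 : x\<^sub>2 x\<^sub>1 x\<^sub>2 = x\<^sub>1 x\<^sub>2 x\<^sub>1\<rangle>\<close>.\<close>

type_synonym letter = "gen \<times> bool"

inductive braid_eq :: "letter list \<Rightarrow> letter list \<Rightarrow> bool" where
  refl: "braid_eq u u"
| sym: "braid_eq u v \<Longrightarrow> braid_eq v u"
| trans: "braid_eq u v \<Longrightarrow> braid_eq v w \<Longrightarrow> braid_eq u w"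
| cancel: "braid_eq (u @ [(k, e), (k, \<not> e)] @ v) (u @ v)"
| braid: "braid_eq (u @ [(X2, True), (X1, True), (X2, True)] @ v)
                   (u @ [(X1, True), (X2, True), (X1, True)] @ v)"

lemma braid_eq_append_left: "braid_eq u v \<Longrightarrow> braid_eq (w @ u) (w @ v)"
proof (induction rule: braid_eq.induct)
  case (cancel u k e v)
  show ?case using braid_eq.cancel[of "w @ u" k e v] by simp
next
  case (braid u v)
  show ?case using braid_eq.braid[of "w @ u" v] by simp
qed (blast intro: braid_eq.intros)+

lemma braid_eq_append_right: "braid_eq u v \<Longrightarrow> braid_eq (u @ w) (v @ w)"
proof (induction rule: braid_eq.induct)
  case (cancel u k e v)
  show ?case using braid_eq.cancel[of u k e "v @ w"] by simp
next
  case (braid u v)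
  show ?case using braid_eq.braid[of u "v @ w"] by simp
qed (blast intro: braid_eq.intros)+

lemma braid_eq_append:
  "braid_eq u u' \<Longrightarrow> braid_eq v v' \<Longrightarrow> braid_eq (u @ v) (u' @ v')"
  by (blast intro: braid_eq.trans braid_eq_append_left braid_eq_append_right)

quotient_type braid3 = "letter list" / braid_eq
  by (rule equivpI) (auto intro!: reflpI sympI transpI intro: braid_eq.intros)

lift_definition braid3_one :: braid3 is "[]" .

lift_definition braid3_mult :: "braid3 \<Rightarrow> braid3 \<Rightarrow> braid3" is append
  by (rule braid_eq_append)

lift_definition gx :: "gen \<Rightarrow> braid3" is "\<lambda>k. [(k, True)]" .

definition B3 :: "braid3 monoid" where
  "B3 = \<lparr>carrier = UNIV, mult = braid3_mult, one = braid3_one\<rparr>"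

definition inv_word :: "letter list \<Rightarrow> letter list" where
  "inv_word w = rev (map (apsnd Not) w)"

lemma braid_eq_inv_word: "braid_eq (inv_word w @ w) []"
proof (induction w)
  case Nil
  show ?case by (simp add: inv_word_def braid_eq.refl)
next
  case (Cons a w)
  obtain k e where a: "a = (k, e)" by (cases a)
  have "braid_eq (inv_word (a # w) @ a # w) (inv_word w @ w)"
    using braid_eq.cancel[of "inv_word w" k "\<not> e" w] by (simp add: inv_word_def a)
  with Cons.IH show ?case by (blast intro: braid_eq.trans)
qed

lemma group_B3: "group B3"
proof (rule groupI)
  fix x y z assume "x \<in> carrier B3" "y \<in> carrier B3" "z \<in> carrier B3"
  show "x \<otimes>\<^bsub>B3\<^esub> y \<otimes>\<^bsub>B3\<^esub> z = x \<otimes>\<^bsub>B3\<^esub> (y \<otimes>\<^bsub>B3\<^esub> z)"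
    unfolding B3_def by simp (transfer, simp add: braid_eq.refl)
next
  fix x assume "x \<in> carrier B3"
  show "\<one>\<^bsub>B3\<^esub> \<otimes>\<^bsub>B3\<^esub> x = x"
    unfolding B3_def by simp (transfer, simp add: braid_eq.refl)
  have "\<exists>y. braid3_mult y x = braid3_one"
    by transfer (blast intro: braid_eq_inv_word)
  then show "\<exists>y\<in>carrier B3. y \<otimes>\<^bsub>B3\<^esub> x = \<one>\<^bsub>B3\<^esub>"
    by (simp add: B3_def)
qed (simp_all add: B3_def)

lemma gx_braid_relation:
  "gx X2 \<otimes>\<^bsub>B3\<^esub> gx X1 \<otimes>\<^bsub>B3\<^esub> gx X2 = gx X1 \<otimes>\<^bsub>B3\<^esub> gx X2 \<otimes>\<^bsub>B3\<^esub> gx X1"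
  unfolding B3_def by simp (transfer, use braid_eq.braid[of "[]" "[]"] in simp)

definition list_prod :: "braid3 list \<Rightarrow> braid3" where
  "list_prod bs = foldr (\<otimes>\<^bsub>B3\<^esub>) bs \<one>\<^bsub>B3\<^esub>"

definition MB3 :: "braid3 set" where
  "MB3 = {list_prod (map gx ks) | ks. True}"

definition Delta3 :: braid3 where
  "Delta3 = gx X1 \<otimes>\<^bsub>B3\<^esub> gx X2 \<otimes>\<^bsub>B3\<^esub> gx X1"

definition MB3_plus :: "braid3 set" where
  "MB3_plus = MB3 - (Delta3 <#\<^bsub>B3\<^esub> MB3)"

definition Delta_form :: "int \<Rightarrow> braid3 \<Rightarrow> braid3" where
  "Delta_form r W = Delta3 [^]\<^bsub>B3\<^esub> r \<otimes>\<^bsub>B3\<^esub> W"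

definition conj_class :: "braid3 \<Rightarrow> braid3 set" where
  "conj_class b = {g \<otimes>\<^bsub>B3\<^esub> b \<otimes>\<^bsub>B3\<^esub> inv\<^bsub>B3\<^esub> g | g. g \<in> carrier B3}"

text \<open>The maximum below exists for every conjugacy class \<open>C\<close>. The set of admissible \<open>r\<close> is
  in general infinite, so \<open>Max\<close> would not be appropriate.\<close>

definition class_exp :: "braid3 set \<Rightarrow> int" where
  "class_exp C = (GREATEST r. \<exists>W\<in>MB3_plus. Delta_form r W \<in> C)"

definition summit_set :: "braid3 set \<Rightarrow> braid3 set" where
  "summit_set C =
     {Delta_form r W | r W. Delta_form r W \<in> C \<and> W \<in> MB3_plus \<and> r = class_exp C}"

definition summit_word :: "int \<Rightarrow> braid3 \<Rightarrow> bool" where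
  "summit_word r W \<longleftrightarrow>
     W \<in> MB3_plus \<and> Delta_form r W \<in> summit_set (conj_class (Delta_form r W))"

definition syllable_prod :: "nat \<Rightarrow> (nat \<Rightarrow> gen) \<Rightarrow> (nat \<Rightarrow> nat) \<Rightarrow> braid3" where
  "syllable_prod h i s = list_prod (map (\<lambda>j. gx (i j) [^]\<^bsub>B3\<^esub> s j) [1..<h+1])"

definition is_syllable_form :: "nat \<Rightarrow> (nat \<Rightarrow> gen) \<Rightarrow> (nat \<Rightarrow> nat) \<Rightarrow> bool" where
  "is_syllable_form h i s \<longleftrightarrow>
     (\<forall>j. 1 \<le> j \<and> j < h \<longrightarrow> i j \<noteq> i (j + 1)) \<and> (\<forall>j\<in>{1..h}. 1 \<le> s j)"

end

theory Submission imports Defs begin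

text \<open>
  A positive word without a factor \<open>aba\<close> (\<open>a \<noteq> b\<close>) is called rigid; the elements of \<open>MB3_plus\<close> are
  exactly the values of rigid words. Let \<open>u = \<Delta>\<^sup>r W\<close> with \<open>W\<close> rigid of length at least 3, and let
  \<open>W'\<close> be the word with \<open>W \<Delta>\<^sup>r = \<Delta>\<^sup>r W'\<close>. If \<open>W' W\<close> is rigid, then so are the positive parts of
  all powers of \<open>u\<close>, hence \<open>u\<^sup>n\<close> has infimum exactly \<open>n r\<close>; a conjugate of infimum at least \<open>r + 1\<close>
  would force the infimum of \<open>u\<^sup>n\<close> to be at least \<open>n (r + 1)\<close> up to a bounded error. If \<open>W' W\<close> is
  not rigid, conjugating by one letter produces a factor \<open>\<Delta>\<close>. Words of at most two letters are
  summit words because \<open>\<Delta>\<close> has exponent sum 3.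
\<close>

section \<open>Positive words and their values\<close>

interpretation B3: group B3 by (rule group_B3)

lemma carrier_B3 [simp]: "carrier B3 = UNIV"
  by (simp add: B3_def)

abbreviation braid_times (infixl "\<cdot>" 70) where "x \<cdot> y \<equiv> x \<otimes>\<^bsub>B3\<^esub> y"
abbreviation binv where "binv x \<equiv> inv\<^bsub>B3\<^esub> x"
abbreviation Dpow :: "int \<Rightarrow> braid3" where "Dpow r \<equiv> Delta3 [^]\<^bsub>B3\<^esub> r"

lemma times_assoc: "x \<cdot> y \<cdot> z = x \<cdot> (y \<cdot> z)"
  by (simp add: B3.m_assoc)

lemma Dpow_add: "Dpow (r + q) = Dpow r \<cdot> Dpow q"
  by (simp add: B3.int_pow_mult)

definition ev :: "gen list \<Rightarrow> braid3" where
  "ev ks = list_prod (map gx ks)"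

lemma ev_Nil [simp]: "ev [] = \<one>\<^bsub>B3\<^esub>"
  and ev_Cons: "ev (k # ks) = gx k \<cdot> ev ks"
  by (simp_all add: ev_def list_prod_def)

lemma ev_single: "ev [k] = gx k"
  by (simp add: ev_Cons)

lemma ev_append: "ev (ks @ ls) = ev ks \<cdot> ev ls"
  by (induction ks) (simp_all add: ev_Cons times_assoc)

lemma MB3_eq_range: "MB3 = range ev"
  by (auto simp: MB3_def ev_def)

lemma MB3_ev [simp]: "ev ks \<in> MB3"
  by (simp add: MB3_eq_range)

lemma Delta3_eq_ev: "Delta3 = ev [X1, X2, X1]"
  by (simp add: Delta3_def ev_Cons times_assoc)

text \<open>The bridge to representatives: functions lifted from signed words, such as
  \<open>nf\<close>, can then be evaluated on \<open>ev ks\<close>.\<close>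

lemma ev_eq_abs: "ev ks = abs_braid3 (map (\<lambda>k. (k, True)) ks)"
proof (induction ks)
  case Nil
  then show ?case by (simp add: B3_def braid3_one_def)
next
  case (Cons k ks)
  then show ?case
    by (simp add: ev_Cons B3_def gx.abs_eq braid3_mult.abs_eq)
qed

lemma abs_Cons: "abs_braid3 (a # w) = abs_braid3 [a] \<cdot> abs_braid3 w"
  by (simp add: B3_def braid3_mult.abs_eq)

lemma abs_letter_pos: "abs_braid3 [(k, True)] = gx k"
  by (simp add: gx.abs_eq)

lemma abs_letter_neg: "abs_braid3 [(k, False)] = binv (gx k)"
proof (rule B3.inv_equality[symmetric])
  have "braid_eq [(k, False), (k, True)] []"
    using braid_eq.cancel[of "[]" k False "[]"] by simp
  then have "abs_braid3 [(k, False), (k, True)] = abs_braid3 []"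
    by (simp add: braid3.abs_eq_iff)
  then show "abs_braid3 [(k, False)] \<cdot> gx k = \<one>\<^bsub>B3\<^esub>"
    by (simp add: B3_def gx.abs_eq braid3_mult.abs_eq braid3_one_def)
qed simp_all

section \<open>Moving generators past Delta\<close>

fun other :: "gen \<Rightarrow> gen" where
  "other X1 = X2"
| "other X2 = X1"

lemma other_other [simp]: "other (other k) = k"
  by (cases k) simp_all

lemma other_neq [simp]: "other k \<noteq> k" "k \<noteq> other k"
  by (cases k, simp_all)+

lemma other_inj [simp]: "other k = other l \<longleftrightarrow> k = l"
  by (cases k; cases l) simp_all

lemma neq_gen_iff: "k \<noteq> l \<longleftrightarrow> k = other l"
  by (cases k; cases l) simp_all

lemma map_other_other [simp]: "map (other \<circ> other) ks = ks"
  by (simp add: o_def)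

lemma ev_alternating: "ev [a, other a, a] = Delta3"
  using gx_braid_relation by (cases a) (simp_all add: Delta3_def ev_Cons times_assoc)

text \<open>The word \<open>k, other k, k, other k\<close> is read in two ways: its last three
  letters form Delta, and so do its first three.\<close>

lemma gx_Delta3: "gx k \<cdot> Delta3 = Delta3 \<cdot> gx (other k)"
proof -
  have "gx k \<cdot> Delta3 = ev [k, other k, k, other k]"
    using ev_alternating[of "other k"] by (simp add: ev_Cons)
  also have "\<dots> = ev [k, other k, k] \<cdot> gx (other k)"
    by (simp add: ev_Cons times_assoc)
  finally show ?thesis by (simp add: ev_alternating)
qed

text \<open>Conjugation by the \<open>r\<close>-th power of Delta on words. Delta swaps the
  generators and its square is central, so only the parity of \<open>r\<close> matters.\<close>

definition twist :: "int \<Rightarrow> gen list \<Rightarrow> gen list" where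
  "twist r ks = (if even r then ks else map other ks)"

lemma twist_append [simp]: "twist r (ks @ ls) = twist r ks @ twist r ls"
  by (simp add: twist_def)

lemma twist_same [simp]: "twist r (twist r ks) = ks"
  by (simp add: twist_def)

lemma length_twist [simp]: "length (twist r ks) = length ks"
  by (simp add: twist_def)

lemma ev_Delta3: "ev ks \<cdot> Delta3 = Delta3 \<cdot> ev (map other ks)"
proof (induction ks)
  case (Cons k ks)
  have "ev (k # ks) \<cdot> Delta3 = gx k \<cdot> (Delta3 \<cdot> ev (map other ks))"
    by (simp add: ev_Cons times_assoc Cons)
  also have "\<dots> = Delta3 \<cdot> ev (map other (k # ks))"
    by (simp add: ev_Cons gx_Delta3 flip: times_assoc)
  finally show ?case .
qed simp

lemma ev_Dpow: "ev ks \<cdot> Dpow r = Dpow r \<cdot> ev (twist r ks)"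
proof (induction r arbitrary: ks rule: int_induct[of _ 0])
  case base
  then show ?case by (simp add: twist_def)
next
  case (step1 i)
  have "ev ks \<cdot> Dpow (i + 1) = Dpow i \<cdot> (ev (twist i ks) \<cdot> Delta3)"
    by (simp add: Dpow_add step1 flip: times_assoc)
  also have "\<dots> = Dpow (i + 1) \<cdot> ev (map other (twist i ks))"
    by (simp add: ev_Delta3 Dpow_add times_assoc)
  also have "map other (twist i ks) = twist (i + 1) ks"
    by (simp add: twist_def)
  finally show ?case .
next
  case (step2 i)
  \<comment> \<open>Downward step: \<open>ls\<close> is chosen so that moving one Delta across it
    gives \<open>twist i ks\<close>. The claim is checked after right multiplication by Delta, which
    is then cancelled.\<close>
  define ls where "ls = map other (twist i ks)"
  have ls: "ls = twist (i - 1) ks"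
    by (simp add: twist_def ls_def)
  have D: "Dpow i = Dpow (i - 1) \<cdot> Delta3"
    using Dpow_add[of "i - 1" 1] by simp
  have "ev ks \<cdot> Dpow (i - 1) \<cdot> Delta3 = Dpow i \<cdot> ev (twist i ks)"
    using step2.IH[of ks] by (simp add: D times_assoc)
  also have "\<dots> = Dpow (i - 1) \<cdot> (Delta3 \<cdot> ev (map other ls))"
    by (simp add: D ls_def times_assoc)
  also have "\<dots> = Dpow (i - 1) \<cdot> ev ls \<cdot> Delta3"
    by (simp add: times_assoc flip: ev_Delta3)
  finally show ?case by (simp add: ls)
qed

section \<open>Words without an alternating triple\<close>

definition rigid :: "gen list \<Rightarrow> bool" where
  "rigid ks \<longleftrightarrow> (\<forall>us a vs. ks \<noteq> us @ [a, other a, a] @ vs)"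

lemma rigidI: "(\<And>us a vs. ks = us @ [a, other a, a] @ vs \<Longrightarrow> False) \<Longrightarrow> rigid ks"
  by (auto simp: rigid_def)

lemma not_rigid: "\<not> rigid (us @ [a, other a, a] @ vs)"
  by (auto simp: rigid_def)

lemma rigid_Nil [simp]: "rigid []"
  by (simp add: rigid_def)

lemma rigid_append_right: "rigid (us @ vs) \<Longrightarrow> rigid vs"
  using not_rigid by (force intro: rigidI simp flip: append_assoc)

lemma rigid_Cons: "rigid (a # ks) \<longleftrightarrow> rigid ks \<and> (\<forall>vs. ks \<noteq> other a # a # vs)"
proof
  assume r: "rigid (a # ks)"
  then show "rigid ks \<and> (\<forall>vs. ks \<noteq> other a # a # vs)"
    using rigid_append_right[of "[a]" ks] not_rigid[of "[]" a] by auto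
next
  assume r: "rigid ks \<and> (\<forall>vs. ks \<noteq> other a # a # vs)"
  show "rigid (a # ks)"
  proof (rule rigidI)
    fix us c vs assume "a # ks = us @ [c, other c, c] @ vs"
    then show False using r not_rigid by (cases us) auto
  qed
qed

lemma rigid_rev: "rigid (rev ks) \<longleftrightarrow> rigid ks"
proof -
  have "rigid (rev ks)" if "rigid ks" for ks
  proof (rule rigidI)
    fix us a vs assume "rev ks = us @ [a, other a, a] @ vs"
    then have "ks = rev vs @ [a, other a, a] @ rev us"
      by (simp add: rev_swap)
    then show False using not_rigid that by blast
  qed
  from this[of ks] this[of "rev ks"] show ?thesis by auto
qed

lemma rigid_map_other [simp]: "rigid (map other ks) \<longleftrightarrow> rigid ks"
  proof -
  have "rigid (map other ks)" if "rigid ks" for ks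
    using that by (induction ks) (auto simp: rigid_Cons map_eq_Cons_conv)
  from this[of ks] this[of "map other ks"] show ?thesis by auto
qed

lemma rigid_twist [simp]: "rigid (twist r ks) \<longleftrightarrow> rigid ks"
  by (simp add: twist_def)

text \<open>A forbidden factor has three letters, so it cannot meet both \<open>us\<close> and
  \<open>ws\<close> across a block of at least two.\<close>

lemma rigid_append3:
  assumes "rigid (us @ vs)" "rigid (vs @ ws)" "2 \<le> length vs"
  shows "rigid (us @ vs @ ws)"
  using assms(1)
proof (induction us)
  case Nil
  then show ?case using assms by simp
next
  case (Cons a us)
  obtain c d vs' where vs: "vs = c # d # vs'"
    using assms(3) by (cases vs; cases "tl vs") auto
  have *: "\<exists>vs''. us @ vs = other a # a # vs''" if "us @ vs @ ws = other a # a # xs" for xs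
    using that by (cases us; cases "tl us") (auto simp: vs)
  from Cons * show ?case by (auto simp: rigid_Cons)
qed

text \<open>The alternating triple is Delta, which moves to the front while swapping the generators
  of the prefix.\<close>

lemma ev_not_rigid:
  assumes "\<not> rigid ks"
  obtains ls where "ev ks = Delta3 \<cdot> ev ls"
proof -
  obtain us a vs where ks: "ks = us @ [a, other a, a] @ vs"
    using assms by (auto simp: rigid_def)
  have "ev ks = ev us \<cdot> Delta3 \<cdot> ev vs"
    unfolding ks ev_append ev_alternating by (simp add: times_assoc)
  also have "\<dots> = Delta3 \<cdot> ev (map other us @ vs)"
    by (simp add: ev_Delta3 ev_append times_assoc)
  finally show ?thesis by (rule that)
qed

section \<open>Uniqueness of the normal form through an action on states\<close>

text \<open>The state \<open>(r, ks)\<close> encodes the Garside normal form \<open>\<Delta>\<^sup>r x\<^bsub>rev ks\<^esub>\<close>; the word is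
  kept reversed because letters act by right multiplication. The clause for an inverse letter
  comes from \<open>x\<^sup>-\<^sup>1 = y x \<Delta>\<^sup>-\<^sup>1\<close>, where \<open>y\<close> is the other generator.\<close>

fun act :: "letter \<Rightarrow> int \<times> gen list \<Rightarrow> int \<times> gen list" where
  "act (k, True) (r, l # m # ks) =
     (if l = other k \<and> m = k then (r + 1, map other ks) else (r, k # l # m # ks))"
| "act (k, True) (r, ks) = (r, k # ks)"
| "act (k, False) (r, ks) =
     (case ks of l # ls \<Rightarrow> if l = k then (r, ls) else (r - 1, other k # k # map other ks)
      | [] \<Rightarrow> (r - 1, [other k, k]))"

lemma rigid_act: "rigid (snd st) \<Longrightarrow> rigid (snd (act a st))"
  by (induction a st rule: act.induct) (auto simp: rigid_Cons split: list.splits)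

lemma act_rigid: "rigid (k # ks) \<Longrightarrow> act (k, True) (r, ks) = (r, k # ks)"
  by (cases ks; cases "tl ks") (auto simp: rigid_Cons)

lemma act_repeat [simp]: "act (k, True) (r, k # ks) = (r, k # k # ks)"
  by (cases ks) auto

text \<open>Rigidity matters here: from \<open>k, other k, k\<close>, deleting the leading
  \<open>k\<close> and putting it back would collapse the triple to a Delta.\<close>

lemma act_cancel: "rigid (snd st) \<Longrightarrow> act (k, \<not> e) (act (k, e) st) = st"
  by (cases "((k, e), st)" rule: act.cases)
    (auto simp: act_rigid rigid_Cons neq_gen_iff o_def split: list.splits if_splits)

text \<open>Right multiplication by Delta equals moving Delta to the left through the whole word.
  The result is symmetric in \<open>a\<close> and \<open>b\<close>, so the action respects the braid
  relation.\<close>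

lemma act_Delta3:
  assumes "rigid ks" "b = other a"
  shows "act (a, True) (act (b, True) (act (a, True) (r, ks))) = (r + 1, map other ks)"
  using assms
  by (cases ks; cases "tl ks"; cases "tl (tl ks)"; cases a)
    (auto simp: act_rigid rigid_Cons neq_gen_iff)

definition run :: "letter list \<Rightarrow> int \<times> gen list \<Rightarrow> int \<times> gen list" where
  "run w st = fold act w st"

lemma run_simps [simp]: "run [] st = st" "run (a # w) st = run w (act a st)"
  "run (v @ w) st = run w (run v st)"
  by (simp_all add: run_def)

lemma rigid_run: "rigid (snd st) \<Longrightarrow> rigid (snd (run w st))"
  by (induction w arbitrary: st) (simp_all add: rigid_act)

lemma run_braid_eq: "braid_eq v w \<Longrightarrow> rigid (snd st) \<Longrightarrow> run v st = run w st"
proof (induction rule: braid_eq.induct)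
  case (cancel u k e v)
  then show ?case using act_cancel[OF rigid_run[OF cancel]] by simp
next
  case (braid u v)
  then have "rigid (snd (run u st))" by (rule rigid_run)
  then show ?case
    using act_Delta3[of "snd (run u st)" X1 X2 "fst (run u st)"]
      act_Delta3[of "snd (run u st)" X2 X1 "fst (run u st)"] by simp
qed simp_all

lift_definition nf :: "braid3 \<Rightarrow> int \<times> gen list" is "\<lambda>w. run w (0, [])"
  by (simp add: run_braid_eq)

lemma fst_act_pos: "fst st \<le> fst (act (k, True) st)"
  by (induction "(k, True)" st rule: act.induct) auto

lemma fst_run_pos: "fst st \<le> fst (run (map (\<lambda>k. (k, True)) ks) st)"
proof (induction ks arbitrary: st)
  case (Cons k ks)
  then show ?case using fst_act_pos[of st k] Cons[of "act (k, True) st"] by (simp add: order_trans)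
qed simp

lemma run_rigid:
  "rigid (rev ks @ ls) \<Longrightarrow> run (map (\<lambda>k. (k, True)) ks) (r, ls) = (r, rev ks @ ls)"
proof (induction ks arbitrary: ls)
  case (Cons k ks)
  have "rigid (k # ls)"
    using Cons.prems rigid_append_right[of "rev ks"] by simp
  then show ?case using Cons by (simp add: act_rigid)
qed simp

text \<open>Compare the exponents in \<open>nf\<close>: letters of a rigid word only pile up and
  leave it at 0, whereas a leading \<open>X1, X2, X1\<close> raises it to 1 and positive letters
  never lower it.\<close>

lemma rigid_not_Delta3:
  assumes "rigid ks"
  shows "ev ks \<noteq> Delta3 \<cdot> ev ls"
proof
  assume "ev ks = Delta3 \<cdot> ev ls"
  then have "nf (ev ks) = nf (ev ([X1, X2, X1] @ ls))"
    by (simp add: Delta3_eq_ev flip: ev_append)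
  moreover have "nf (ev ks) = (0, rev ks)"
    using run_rigid[of ks "[]"] assms by (simp add: ev_eq_abs nf.abs_eq rigid_rev)
  moreover have "nf (ev ([X1, X2, X1] @ ls)) = run (map (\<lambda>k. (k, True)) ls) (1, [])"
    by (simp add: ev_eq_abs nf.abs_eq)
  ultimately have "(0, rev ks) = run (map (\<lambda>k. (k, True)) ls) (1, [])" by simp
  then show False using fst_run_pos[of "(1, [])" ls] by (metis fst_conv not_one_le_zero)
qed

lemma l_coset_MB3: "x \<in> Delta3 <#\<^bsub>B3\<^esub> MB3 \<longleftrightarrow> (\<exists>ls. x = Delta3 \<cdot> ev ls)"
  by (auto simp: l_coset_def MB3_eq_range)

lemma ev_MB3_plus_iff: "ev ks \<in> MB3_plus \<longleftrightarrow> rigid ks"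
  using rigid_not_Delta3[of ks] ev_not_rigid[of ks]
  by (auto simp: MB3_plus_def l_coset_MB3)

section \<open>Lower bounds for the infimum\<close>

text \<open>Garside's infimum of \<open>x\<close> is the greatest such \<open>q\<close>. Working
  with lower bounds avoids normalising the positive factor.\<close>

definition inf_ge :: "int \<Rightarrow> braid3 \<Rightarrow> bool" where
  "inf_ge q x \<longleftrightarrow> (\<exists>ks. x = Dpow q \<cdot> ev ks)"

lemma inf_ge_times:
  assumes "inf_ge p x" "inf_ge q y"
  shows "inf_ge (p + q) (x \<cdot> y)"
proof -
  obtain ks ls where "x = Dpow p \<cdot> ev ks" "y = Dpow q \<cdot> ev ls"
    using assms by (auto simp: inf_ge_def)
  then have "x \<cdot> y = Dpow p \<cdot> (ev ks \<cdot> Dpow q) \<cdot> ev ls"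
    by (simp add: times_assoc)
  also have "\<dots> = Dpow (p + q) \<cdot> ev (twist q ks @ ls)"
    by (simp add: ev_Dpow ev_append Dpow_add times_assoc)
  finally show ?thesis by (auto simp: inf_ge_def)
qed

lemma inf_ge_ev: "inf_ge 0 (ev ks)"
  by (auto simp: inf_ge_def)

lemma inf_ge_Dpow: "inf_ge r (Dpow r)"
  by (auto simp: inf_ge_def intro: exI[of _ "[]"])

text \<open>The surplus power of Delta is itself a positive word and is absorbed into the positive
  factor.\<close>

lemma inf_ge_mono:
  assumes "inf_ge q x" "p \<le> q"
  shows "inf_ge p x"
proof -
  have *: "inf_ge 0 (Dpow (int n))" for n
  proof (induction n)
    case 0
    then show ?case using inf_ge_ev[of "[]"] by simp
  next
    case (Suc n)
    have "inf_ge 0 Delta3" unfolding Delta3_eq_ev by (rule inf_ge_ev)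
    then show ?case
      using inf_ge_times[OF _ Suc, of 0 Delta3] Dpow_add[of 1 "int n"] by simp
  qed
  obtain ks where "x = Dpow q \<cdot> ev ks" using assms by (auto simp: inf_ge_def)
  then have "x = Dpow p \<cdot> (Dpow (int (nat (q - p))) \<cdot> ev ks)"
    using assms(2) Dpow_add[of p "q - p"] by (simp flip: times_assoc)
  then show ?thesis
    using inf_ge_times[OF inf_ge_Dpow inf_ge_times[OF * inf_ge_ev]] by (metis add_0 add.right_neutral)
qed

text \<open>Each inverse letter costs at most one Delta, because \<open>gx k\<close> times
  \<open>ev [other k, k]\<close> is Delta.\<close>

lemma inf_ge_ex: "\<exists>q. inf_ge q x"
proof -
  have inv: "inf_ge (- 1) (binv (gx k))" for k
  proof -
    have "gx k \<cdot> ev [other k, k] = Delta3"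
      using ev_alternating[of k] by (simp add: ev_Cons)
    then have "ev [other k, k] \<cdot> Dpow (- 1) = binv (gx k) \<cdot> Delta3 \<cdot> binv Delta3"
      by (metis B3.inv_solve_left UNIV_I carrier_B3 B3.int_pow_neg B3.int_pow_1)
    then show ?thesis
      using inf_ge_times[OF inf_ge_ev[of "[other k, k]"] inf_ge_Dpow[of "- 1"]]
      by (simp add: times_assoc)
  qed
  have "\<exists>q. inf_ge q (abs_braid3 w)" for w
  proof (induction w)
    case Nil
    then show ?case using inf_ge_ev[of "[]"] by (auto simp: B3_def braid3_one_def)
  next
    case (Cons a w)
    obtain k e where a: "a = (k, e)" by (cases a)
    have "\<exists>q. inf_ge q (abs_braid3 [a])"
      using inv[of k] inf_ge_ev[of "[k]"]
      by (cases e) (auto simp: a abs_letter_pos abs_letter_neg ev_single)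
    then show ?case
      using Cons inf_ge_times unfolding abs_Cons[of a w] by blast
  qed
  then show ?thesis by (induction x rule: braid3.abs_induct) blast
qed

lemma inf_ge_pow: "inf_ge q x \<Longrightarrow> inf_ge (int n * q) (x [^]\<^bsub>B3\<^esub> n)"
proof (induction n)
  case 0
  then show ?case using inf_ge_ev[of "[]"] by simp
next
  case (Suc n)
  then show ?case using inf_ge_times[of "int n * q" _ q x] by (simp add: algebra_simps)
qed

lemma rigid_inf_ge:
  assumes "rigid ks" "inf_ge q (Dpow r \<cdot> ev ks)"
  shows "q \<le> r"
proof (rule ccontr)
  assume "\<not> q \<le> r"
  then have "inf_ge (r + 1) (Dpow r \<cdot> ev ks)"
    using assms(2) inf_ge_mono by simp
  then obtain ls where "Dpow r \<cdot> ev ks = Dpow r \<cdot> (Delta3 \<cdot> ev ls)"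
    by (auto simp: inf_ge_def Dpow_add times_assoc)
  then show False using rigid_not_Delta3[OF assms(1)] by simp
qed

section \<open>Exponent sum\<close>

text \<open>The abelianisation map to the integers. It is invariant under conjugation and bounds the
  infimum from above throughout a conjugacy class.\<close>

lift_definition expsum :: "braid3 \<Rightarrow> int" is
  "\<lambda>w. \<Sum>(k, e) \<leftarrow> w. if e then 1 else - 1"
  by (erule braid_eq.induct) auto

lemma expsum_times [simp]: "expsum (x \<cdot> y) = expsum x + expsum y"
  unfolding B3_def by simp (transfer, simp)

lemma expsum_one [simp]: "expsum \<one>\<^bsub>B3\<^esub> = 0"
  unfolding B3_def by simp (transfer, simp)

lemma expsum_gx [simp]: "expsum (gx k) = 1"
  by transfer simp

lemma expsum_ev [simp]: "expsum (ev ks) = int (length ks)"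
  by (induction ks) (simp_all add: ev_Cons)

lemma expsum_inv [simp]: "expsum (binv x) = - expsum x"
  using expsum_times[of x "binv x"] by simp

lemma expsum_Delta3 [simp]: "expsum Delta3 = 3"
  by (simp add: Delta3_def)

lemma expsum_Dpow [simp]: "expsum (Dpow r) = 3 * r"
proof (induction r rule: int_induct[of _ 0])
  case (step1 i)
  then show ?case by (simp add: Dpow_add)
next
  case (step2 i)
  then show ?case using arg_cong[OF Dpow_add[of "i - 1" 1], of expsum] by simp
qed simp

section \<open>Conjugacy classes and the summit exponent\<close>

lemma conj_class_iff: "y \<in> conj_class x \<longleftrightarrow> (\<exists>g. y = g \<cdot> x \<cdot> binv g)"
  by (auto simp: conj_class_def)

lemma conj_class_self: "x \<in> conj_class x"
  unfolding conj_class_iff by (rule exI[of _ "\<one>\<^bsub>B3\<^esub>"]) simp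

lemma conj_class_commute: "y \<cdot> x \<in> conj_class (x \<cdot> y)"
  unfolding conj_class_iff by (rule exI[of _ y]) (simp add: times_assoc)

lemma expsum_conj: "y \<in> conj_class x \<Longrightarrow> expsum y = expsum x"
  by (auto simp: conj_class_iff)

lemma expsum_inf_ge: "inf_ge q x \<Longrightarrow> 3 * q \<le> expsum x"
  by (auto simp: inf_ge_def)

text \<open>The maximum exists because every exponent occurring in the class is at most a third of
  the exponent sum. Arbitrary positive factors may be allowed, since at the maximum the factor is
  automatically free of Delta.\<close>

lemma class_exp_properties:
  fixes x :: braid3
  defines "C \<equiv> conj_class x"
  shows "\<exists>y\<in>C. inf_ge (class_exp C) y" and "y \<in> C \<Longrightarrow> inf_ge q y \<Longrightarrow> q \<le> class_exp C"
proof -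
  define Q where "Q = {q. \<exists>y\<in>C. inf_ge q y}"
  obtain q0 where "inf_ge q0 x" using inf_ge_ex by blast
  then have q0: "q0 \<in> Q" using conj_class_self by (auto simp: Q_def C_def)
  have bound: "3 * q \<le> expsum x" if "q \<in> Q" for q
    using that expsum_inf_ge expsum_conj by (fastforce simp: Q_def C_def)
  \<comment> \<open>\<open>Q\<close> is closed downwards and hence infinite; cutting it at a known
    element \<open>q0\<close> leaves a finite nonempty set.\<close>
  define m where "m = Max (Q \<inter> {q0..})"
  have fin: "finite (Q \<inter> {q0..})"
    by (rule finite_subset[of _ "{q0..expsum x div 3}"]) (use bound in fastforce)+
  have m: "m \<in> Q" using Max_in[OF fin] q0 by (auto simp: m_def)
  have max: "q \<le> m" if "q \<in> Q" for q
  proof (cases "q0 \<le> q")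
    case True
    then show ?thesis using that fin by (simp add: m_def)
  next
    case False
    moreover have "q0 \<le> m" using fin q0 by (simp add: m_def)
    ultimately show ?thesis by simp
  qed
  have "class_exp C = m"
    unfolding class_exp_def
  proof (rule Greatest_equality)
    obtain ks where ks: "Dpow m \<cdot> ev ks \<in> C"
      using m by (auto simp: Q_def inf_ge_def)
    have "ev ks \<in> MB3_plus"
    proof (rule ccontr)
      assume "ev ks \<notin> MB3_plus"
      then obtain ls where "ev ks = Delta3 \<cdot> ev ls"
        by (auto simp: ev_MB3_plus_iff elim: ev_not_rigid)
      then have "Dpow m \<cdot> ev ks = Dpow (m + 1) \<cdot> ev ls"
        by (simp add: Dpow_add times_assoc)
      then have "m + 1 \<in> Q" using ks by (auto simp: Q_def inf_ge_def)
      then show False using max by fastforce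
    qed
    then show "\<exists>W\<in>MB3_plus. Delta_form m W \<in> C"
      using ks by (auto simp: Delta_form_def)
  next
    fix q assume "\<exists>W\<in>MB3_plus. Delta_form q W \<in> C"
    then show "q \<le> m"
      by (intro max) (auto simp: Q_def inf_ge_def Delta_form_def MB3_plus_def MB3_eq_range)
  qed
  then show "\<exists>y\<in>C. inf_ge (class_exp C) y" and "y \<in> C \<Longrightarrow> inf_ge q y \<Longrightarrow> q \<le> class_exp C"
    using m max by (auto simp: Q_def)
qed

text \<open>Removes \<open>GREATEST\<close> from the problem: being a summit word means that no
  conjugate has a larger infimum.\<close>

lemma summit_word_iff:
  assumes "rigid ks"
  shows "summit_word r (ev ks) \<longleftrightarrow>
    (\<forall>q y. y \<in> conj_class (Dpow r \<cdot> ev ks) \<longrightarrow> inf_ge q y \<longrightarrow> q \<le> r)"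
proof -
  define C where "C = conj_class (Dpow r \<cdot> ev ks)"
  have self: "Dpow r \<cdot> ev ks \<in> C" by (simp add: C_def conj_class_self)
  have "summit_word r (ev ks) \<longleftrightarrow> r = class_exp C"
  proof
    assume "summit_word r (ev ks)"
    then obtain ls where ls: "Dpow r \<cdot> ev ks = Dpow (class_exp C) \<cdot> ev ls"
      by (auto simp: summit_word_def summit_set_def Delta_form_def MB3_plus_def MB3_eq_range C_def)
    then have "inf_ge (class_exp C) (Dpow r \<cdot> ev ks)" by (auto simp: inf_ge_def)
    then have "class_exp C \<le> r" by (rule rigid_inf_ge[OF assms])
    moreover have "r \<le> class_exp C"
      using class_exp_properties(2)[of "Dpow r \<cdot> ev ks" "Dpow r \<cdot> ev ks" r] self
      by (auto simp: C_def inf_ge_def)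
    ultimately show "r = class_exp C" by simp
  next
    assume "r = class_exp C"
    then show "summit_word r (ev ks)"
      using self assms
      by (auto simp: summit_word_def summit_set_def Delta_form_def ev_MB3_plus_iff C_def)
  qed
  also have "\<dots> \<longleftrightarrow> (\<forall>q y. y \<in> C \<longrightarrow> inf_ge q y \<longrightarrow> q \<le> r)"
  proof
    assume "r = class_exp C"
    then show "\<forall>q y. y \<in> C \<longrightarrow> inf_ge q y \<longrightarrow> q \<le> r"
      using class_exp_properties(2)[of _ "Dpow r \<cdot> ev ks"] by (simp add: C_def)
  next
    assume *: "\<forall>q y. y \<in> C \<longrightarrow> inf_ge q y \<longrightarrow> q \<le> r"
    have "class_exp C \<le> r" using * class_exp_properties(1) unfolding C_def by blast
    moreover have "inf_ge r (Dpow r \<cdot> ev ks)" by (auto simp: inf_ge_def)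
    ultimately show "r = class_exp C"
      using class_exp_properties(2)[of "Dpow r \<cdot> ev ks"] self unfolding C_def by (meson antisym)
  qed
  finally show ?thesis by (simp add: C_def)
qed

text \<open>A conjugate with infimum at least \<open>q\<close> satisfies
  \<open>3 * q \<le> 3 * r + 2\<close>, hence \<open>q \<le> r\<close>.\<close>

lemma summit_word_short:
  assumes "rigid ks" "length ks \<le> 2"
  shows "summit_word r (ev ks)"
  unfolding summit_word_iff[OF assms(1)]
  using assms(2) by (auto dest!: expsum_conj expsum_inf_ge)

section \<open>Summit words and rigidity at the cyclic junction\<close>

text \<open>The positive part of an \<open>n\<close>-th power once every Delta has moved left: each
  block is twisted once for every factor to its right.\<close>

fun twisted_power :: "int \<Rightarrow> nat \<Rightarrow> gen list \<Rightarrow> gen list" where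
  "twisted_power r 0 ks = []"
| "twisted_power r (Suc n) ks = twist r (twisted_power r n ks) @ ks"

lemma Dpow_ev_power:
  "(Dpow r \<cdot> ev ks) [^]\<^bsub>B3\<^esub> n = Dpow (int n * r) \<cdot> ev (twisted_power r n ks)"
proof (induction n)
  case (Suc n)
  let ?t = "twisted_power r n ks"
  have "(Dpow r \<cdot> ev ks) [^]\<^bsub>B3\<^esub> Suc n = Dpow (int n * r) \<cdot> (ev ?t \<cdot> Dpow r) \<cdot> ev ks"
    by (simp add: Suc times_assoc)
  also have "\<dots> = Dpow (int n * r) \<cdot> Dpow r \<cdot> ev (twisted_power r (Suc n) ks)"
    by (simp add: ev_Dpow ev_append times_assoc)
  also have "Dpow (int n * r) \<cdot> Dpow r = Dpow (int (Suc n) * r)"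
    by (simp add: algebra_simps flip: Dpow_add)
  finally show ?case .
qed simp

text \<open>Neighbouring blocks are twists of \<open>twist r ks @ ks\<close>, and
  \<open>rigid_append3\<close> glues at blocks of at least two letters.\<close>

lemma rigid_twisted_power:
  assumes "rigid (twist r ks @ ks)" "rigid ks" "2 \<le> length ks"
  shows "rigid (twisted_power r n ks)"
proof (induction n)
  case (Suc n)
  show ?case
  proof (cases n)
    case 0
    then show ?thesis using assms by (simp add: twist_def)
  next
    case (Suc m)
    have "rigid (twist r (twisted_power r n ks))" using Suc.IH by simp
    then show ?thesis
      using rigid_append3[of "twist r (twist r (twisted_power r m ks))" "twist r ks" ks] assms
      by (simp add: Suc)
  qed
qed simp

lemma inv_times_cancel [simp]: "binv g \<cdot> (g \<cdot> x) = x" "g \<cdot> (binv g \<cdot> x) = x"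
  by (simp_all flip: times_assoc)

lemma conj_pow: "(g \<cdot> x \<cdot> binv g) [^]\<^bsub>B3\<^esub> (n::nat) = g \<cdot> x [^]\<^bsub>B3\<^esub> n \<cdot> binv g"
  by (induction n) (simp_all add: times_assoc)

lemma summit_word_rigid:
  assumes "rigid (twist r ks @ ks)" "rigid ks" "2 \<le> length ks"
  shows "summit_word r (ev ks)"
  unfolding summit_word_iff[OF assms(2)]
proof (intro allI impI, rule ccontr)
  fix q y assume y: "y \<in> conj_class (Dpow r \<cdot> ev ks)" and q: "inf_ge q y" and "\<not> q \<le> r"
  define x where "x = Dpow r \<cdot> ev ks"
  obtain g where g: "y = g \<cdot> x \<cdot> binv g"
    using y by (auto simp: conj_class_iff x_def)
  then have x: "x = binv g \<cdot> y \<cdot> binv (binv g)"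
    by (simp add: times_assoc)
  obtain a b where ab: "inf_ge a (binv g)" "inf_ge b (binv (binv g))"
    using inf_ge_ex by metis
  have "a + int n * q + b \<le> int n * r" for n
  proof -
    have "inf_ge (a + int n * q + b) (x [^]\<^bsub>B3\<^esub> n)"
      unfolding x conj_pow by (intro inf_ge_times ab inf_ge_pow q)
    then show ?thesis
      unfolding x_def Dpow_ev_power
      by (rule rigid_inf_ge[OF rigid_twisted_power[OF assms]])
  qed
  \<comment> \<open>This \<open>n\<close> is large enough that the gain \<open>n * (q - r)\<close>,
    at least \<open>n\<close>, exceeds the bounded loss from \<open>a + b\<close>.\<close>
  from this[of "nat (\<bar>a + b\<bar> + 1)"]
  have "(\<bar>a + b\<bar> + 1) * (q - r) \<le> - (a + b)" by (simp add: algebra_simps)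
  moreover have "\<bar>a + b\<bar> + 1 \<le> (\<bar>a + b\<bar> + 1) * (q - r)"
    using \<open>\<not> q \<le> r\<close> mult_left_mono[of 1 "q - r" "\<bar>a + b\<bar> + 1"] by simp
  ultimately have "\<bar>a + b\<bar> + 1 \<le> - (a + b)" by (rule order_trans[rotated])
  then show False by simp
qed

text \<open>Both parts being rigid, the triple straddles the junction, with either two or one of its
  letters on the left.\<close>

lemma not_rigid_append:
  assumes "rigid us" "rigid vs" "\<not> rigid (us @ vs)"
  obtains us' a vs' where "us = us' @ [a, other a]" "vs = a # vs'"
  | us' a vs' where "us = us' @ [a]" "vs = other a # a # vs'"
proof -
  obtain ws a xs where eq: "us @ vs = ws @ [a, other a, a] @ xs"
    using assms(3) by (auto simp: rigid_def)
  then consider us' where "us = ws @ us'" "us' @ vs = [a, other a, a] @ xs"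
    | ws' where "vs = ws' @ [a, other a, a] @ xs"
    unfolding append_eq_append_conv2 by blast
  then show ?thesis
  proof cases
    case 1
    then show ?thesis
      using that assms(1,2) not_rigid[of ws a] not_rigid[of "[]" a xs]
      by (auto simp: append_eq_Cons_conv)
  next
    case 2
    then show ?thesis using not_rigid assms(2) by blast
  qed
qed

text \<open>Moving one letter around the cyclic word turns the triple at the junction into an actual
  factor. With at least three letters, the other two letters of the triple survive the move.\<close>

lemma not_summit_word:
  assumes "\<not> rigid (twist r ks @ ks)" "rigid ks" "3 \<le> length ks"
  shows "\<not> summit_word r (ev ks)"
proof -
  have *: ?thesis if "Dpow r \<cdot> ev ls \<in> conj_class (Dpow r \<cdot> ev ks)" "\<not> rigid ls" for ls
  proof -
    obtain ms where "ev ls = Delta3 \<cdot> ev ms" using \<open>\<not> rigid ls\<close> by (rule ev_not_rigid)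
    then have "inf_ge (r + 1) (Dpow r \<cdot> ev ls)"
      by (auto simp: inf_ge_def Dpow_add times_assoc)
    then show ?thesis using that(1) unfolding summit_word_iff[OF assms(2)] by fastforce
  qed
  show ?thesis
    using assms(1)
  proof (rule not_rigid_append[rotated 2])
    show "rigid (twist r ks)" "rigid ks" using assms(2) by simp_all
  next
    fix us a vs assume ab: "twist r ks = us @ [a, other a]" "ks = a # vs"
    have "twist r (twist r ks) = twist r us @ twist r [a, other a]"
      by (simp only: ab(1) twist_append)
    then have ks: "a # vs = twist r us @ twist r [a, other a]"
      by (simp flip: ab(2))
    \<comment> \<open>The third letter ensures that deleting the first letter of \<open>ks\<close>
      leaves its last two in place.\<close>
    obtain c us' where us: "us = c # us'" using assms(3) ab(1)
      by (cases us) (auto dest: arg_cong[where f = length])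
    have vs: "vs = twist r us' @ twist r [a, other a]"
      using ks by (auto simp: us twist_def split: if_splits)
    have nr: "\<not> rigid (vs @ twist r [a])"
    proof -
      have "vs @ twist r [a] = twist r (us' @ [a, other a, a] @ [])"
        unfolding vs by (simp flip: twist_append)
      then show ?thesis by (simp only: rigid_twist not_rigid not_False_eq_True)
    qed
    \<comment> \<open>The first letter of \<open>ks\<close> crosses the power of Delta, and a cyclic
      shift then puts it at the end, completing the triple.\<close>
    have "Dpow r \<cdot> ev ks = ev (twist r [a]) \<cdot> (Dpow r \<cdot> ev vs)"
      using ev_Dpow[of "twist r [a]" r] by (simp add: ab(2) ev_Cons flip: times_assoc)
    then have "Dpow r \<cdot> ev (vs @ twist r [a]) \<in> conj_class (Dpow r \<cdot> ev ks)"
      using conj_class_commute[of "Dpow r \<cdot> ev vs" "ev (twist r [a])"]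
      by (simp add: ev_append times_assoc)
    then show ?thesis using nr by (rule *)
  next
    fix us a vs assume ab: "twist r ks = us @ [a]" "ks = other a # a # vs"
    have "twist r (twist r ks) = twist r us @ twist r [a]"
      by (simp only: ab(1) twist_append)
    then have ks: "ks = twist r us @ twist r [a]"
      by simp
    \<comment> \<open>Dual case: the last letter of \<open>ks\<close> is moved to the front, so its
      first two letters must remain after the last is deleted.\<close>
    obtain vs' where us: "twist r us = other a # a # vs'"
    proof -
      have "length us \<ge> 2" using assms(3) ab(1) by (auto dest: arg_cong[where f = length])
      then show ?thesis using that ks ab(2)
        by (cases "twist r us"; cases "tl (twist r us)") (auto dest: arg_cong[where f = length])
    qed
    have nr: "\<not> rigid ([a] @ twist r us)"
      by (simp add: us rigid_Cons)
    have "Dpow r \<cdot> ev ([a] @ twist r us) = ev (twist r [a]) \<cdot> (Dpow r \<cdot> ev (twist r us))"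
      using ev_Dpow[of "twist r [a]" r] by (simp add: ev_Cons flip: times_assoc)
    moreover have "Dpow r \<cdot> ev ks = Dpow r \<cdot> ev (twist r us) \<cdot> ev (twist r [a])"
      by (simp add: ks ev_append times_assoc)
    ultimately have "Dpow r \<cdot> ev ([a] @ twist r us) \<in> conj_class (Dpow r \<cdot> ev ks)"
      using conj_class_commute by metis
    then show ?thesis using nr by (rule *)
  qed
qed

lemma summit_word_iff_rigid:
  assumes "rigid ks" "3 \<le> length ks"
  shows "summit_word r (ev ks) \<longleftrightarrow> rigid (twist r ks @ ks)"
  using assms summit_word_rigid[of r ks] not_summit_word[of r ks] by auto

section \<open>Translation to syllable exponents\<close>

text \<open>Indexed by a list of positions, so that a word can be cut at a chosen syllable.\<close>

definition syllables :: "(nat \<Rightarrow> gen) \<Rightarrow> (nat \<Rightarrow> nat) \<Rightarrow> nat list \<Rightarrow> gen list" where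
  "syllables i s js = concat (map (\<lambda>j. replicate (s j) (i j)) js)"

lemma syllables_simps [simp]:
  "syllables i s [] = []"
  "syllables i s (j # js) = replicate (s j) (i j) @ syllables i s js"
  "syllables i s (js @ js') = syllables i s js @ syllables i s js'"
  by (simp_all add: syllables_def)

lemma gx_pow: "gx k [^]\<^bsub>B3\<^esub> (n::nat) = ev (replicate n k)"
proof (induction n)
  case (Suc n)
  then show ?case
    by (simp add: ev_append flip: ev_single replicate_append_same)
qed simp

lemma list_prod_syllables:
  "list_prod (map (\<lambda>j. gx (i j) [^]\<^bsub>B3\<^esub> s j) js) = ev (syllables i s js)"
proof (induction js)
  case Nil
  then show ?case by (simp add: list_prod_def)
next
  case (Cons j js)
  then show ?case by (simp add: list_prod_def gx_pow ev_append)
qed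

lemma length_syllables: "length (syllables i s js) = sum_list (map s js)"
  by (induction js) simp_all

lemma length_le_syllables: "(\<And>j. j \<in> set js \<Longrightarrow> 1 \<le> s j) \<Longrightarrow> length js \<le> length (syllables i s js)"
  by (induction js) (fastforce simp: length_syllables)+

lemma syllable_split:
  assumes "1 \<le> j" "j \<le> h"
  shows "[1..<h + 1] = [1..<j] @ j # [j + 1..<h + 1]"
  using assms upt_add_eq_append[of 1 j "h + 1 - j"] by (simp add: upt_conv_Cons)

lemma syllable_form_alternates:
  assumes "is_syllable_form h i s" "1 \<le> j" "j \<le> h"
  shows "i j = (if odd j then i 1 else other (i 1))"
  using assms(2,3)
proof (induction j rule: dec_induct)
  case (step n)
  have "i n \<noteq> i (Suc n)" using step.hyps step.prems assms(1) by (simp add: is_syllable_form_def)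
  then show ?case using step by (auto simp: neq_gen_iff split: if_splits)
qed simp

text \<open>A triple across the junction needs distinct letters there and a one-letter syllable at
  one end of \<open>w\<close>. Inner syllables of a rigid word have at least two letters anyway, so
  the end condition may be stated for all \<open>j\<close>.\<close>

lemma rigid_cyclic_iff:
  fixes r :: int and h :: nat and i s
  defines "w \<equiv> syllables i s [1..<h + 1]"
  assumes syll: "is_syllable_form h i s" and w: "rigid w" "2 \<le> length w"
  shows "rigid (twist r w @ w) \<longleftrightarrow>
    (int h + 1) mod 2 = r mod 2 \<or> (\<forall>j\<in>{1..h}. 2 \<le> s j)"
proof -
  have h: "1 \<le> h"
    using w(2) by (cases h) (auto simp: w_def)
  have pos: "\<exists>n. s j = Suc n" if "1 \<le> j" "j \<le> h" for j
    using syll that by (cases "s j") (force simp: is_syllable_form_def)+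
  have split: "w = syllables i s [1..<j] @ replicate (s j) (i j) @ syllables i s [j + 1..<h + 1]"
    if "1 \<le> j" "j \<le> h" for j
    unfolding w_def using syllable_split[OF that] by simp
  \<comment> \<open>The junction of \<open>twist r w @ w\<close> has \<open>c\<close> on its left
    and \<open>d\<close> on its right.\<close>
  define d where "d = i 1"
  define c where "c = (if even r then i h else other (i h))"
  have twist_h: "twist r [i h] = [c]" "twist r [other (i h)] = [other c]"
    by (auto simp: twist_def c_def)
  have i_h: "i h = (if odd h then d else other d)"
    using syllable_form_alternates[OF syll, of h] h by (simp add: d_def)
  \<comment> \<open>The syllables alternate, so \<open>c\<close> and \<open>d\<close> agree exactly
    under condition (i).\<close>
  have parity: "c = d \<longleftrightarrow> (int h + 1) mod 2 = r mod 2"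
  proof -
    have "(int h + 1) mod 2 = r mod 2 \<longleftrightarrow> (odd h \<longleftrightarrow> even r)" by presburger
    then show ?thesis by (auto simp: c_def i_h)
  qed
  obtain w1 where first: "w = d # w1"
    using split[of 1] pos[of 1] h by (auto simp: d_def)
  obtain w2 where last: "w = w2 @ [i h]"
    using split[of h] pos[of h] h by (auto simp flip: replicate_append_same)
  have last': "twist r w = twist r w2 @ [c]"
    by (simp only: last twist_append twist_h)
  show ?thesis
  proof
    assume rigid: "rigid (twist r w @ w)"
    show "(int h + 1) mod 2 = r mod 2 \<or> (\<forall>j\<in>{1..h}. 2 \<le> s j)"
    proof (rule ccontr)
      assume contra: "\<not> ?thesis"
      then have c: "c = other d" using parity by (auto simp: neq_gen_iff)
      obtain j where j: "1 \<le> j" "j \<le> h" "s j = 1"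
        using contra pos by (metis One_nat_def Suc_1 Suc_leI atLeastAtMost_iff le_neq_implies_less zero_less_Suc not_less_eq_eq)
      note w_j = split[OF j(1,2), unfolded j(3)]
      have "h \<noteq> 1" using w(2) w_j j by auto
      have prev: "\<exists>us. syllables i s [1..<j] = us @ [other (i j)]" if j1: "j \<noteq> 1"
      proof -
        obtain m where m: "j = Suc m" "1 \<le> m" using j j1 by (cases j) auto
        then have "i m = other (i j)"
          using syll j by (auto simp: is_syllable_form_def simp flip: neq_gen_iff)
        moreover have "[1..<j] = [1..<m] @ [m]" using m by simp
        ultimately show ?thesis
          using pos[of m] m j by (auto simp flip: replicate_append_same)
      qed
      have "next": "\<exists>vs. syllables i s [j + 1..<h + 1] = other (i j) # vs" if "j \<noteq> h"
      proof -
        have "i j \<noteq> i (j + 1)"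
          using syll j that by (simp add: is_syllable_form_def)
        then have "i (j + 1) = other (i j)"
          by (auto simp flip: neq_gen_iff)
        moreover have "[j + 1..<h + 1] = (j + 1) # [j + 2..<h + 1]"
          using that j by (simp add: upt_conv_Cons)
        ultimately show ?thesis
          using pos[of "j + 1"] j that by auto
      qed
      \<comment> \<open>A one-letter syllable yields a triple at the junction if it is first or
        last, and inside \<open>w\<close> otherwise.\<close>
      consider "j = 1" | "j = h" | "j \<noteq> 1" "j \<noteq> h" by blast
      then show False
      proof cases
        case 1
        then obtain vs where vs: "w = d # other d # vs"
          using w_j "next" \<open>h \<noteq> 1\<close> by (auto simp: d_def)
        have "twist r w @ w = twist r w2 @ [c, other c, c] @ vs"
          unfolding last' by (simp add: vs c)
        then show False using rigid not_rigid by metis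
      next
        case 2
        then obtain us where "w = us @ [other (i h), i h]"
          using w_j prev \<open>h \<noteq> 1\<close> by auto
        then have "twist r w = twist r us @ twist r [other (i h)] @ twist r [i h]"
          by (simp flip: twist_append)
        then have "twist r w @ w = twist r us @ [d, other d, d] @ w1"
          by (simp add: twist_h c first)
        then show False using rigid not_rigid by metis
      next
        case 3
        then obtain us vs where "w = us @ [other (i j), other (other (i j)), other (i j)] @ vs"
          using w_j prev "next" by auto
        then show False using w(1) not_rigid by metis
      qed
    qed
  next
    assume *: "(int h + 1) mod 2 = r mod 2 \<or> (\<forall>j\<in>{1..h}. 2 \<le> s j)"
    show "rigid (twist r w @ w)"
    proof (rule ccontr)
      assume "\<not> rigid (twist r w @ w)"
      then show False
      proof (rule not_rigid_append[rotated 2])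
        fix us a vs assume a: "twist r w = us @ [a, other a]" "w = a # vs"
        then have "d = a" "c = other a" using first last' by auto
        \<comment> \<open>The junction letters differ, so (i) fails and (ii) applies; then
          \<open>w\<close> ends in a repeated letter, which contradicts the alternating end
          \<open>a, other a\<close>.\<close>
        then have "2 \<le> s h" using * parity h by auto
        then obtain n where "s h = Suc (Suc n)" by (auto dest: le_Suc_ex)
        then have "replicate (s h) (i h) = replicate n (i h) @ [i h, i h]"
          by (simp add: replicate_app_Cons_same)
        then obtain us' where "w = us' @ [i h, i h]"
          using split[OF h order_refl] by simp
        then have "twist r w = twist r us' @ twist r [i h] @ twist r [i h]"
          by (simp flip: twist_append)
        then show False using a(1) \<open>c = other a\<close> by (auto simp: twist_h)
      next
        fix us a vs assume a: "twist r w = us @ [a]" "w = other a # a # vs"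
        then have "d = other a" "c = a" using first last' by auto
        then have "2 \<le> s 1" using * parity h by auto
        then obtain n where "s 1 = Suc (Suc n)" by (auto dest: le_Suc_ex)
        then show False using split[of 1] h a(2) by auto
      qed (use w(1) in simp_all)
    qed
  qed
qed

section \<open>The summit criterion in syllable form\<close>

theorem theorem2:
  fixes r :: int and W :: braid3 and h :: nat
    and i :: "nat \<Rightarrow> gen" and s :: "nat \<Rightarrow> nat"
  assumes normal_form: "W \<in> MB3_plus"
    and syllables: "is_syllable_form h i s"
    and W_eq: "W = syllable_prod h i s"
  shows "summit_word r W \<longleftrightarrow>
      ((even r \<and> Delta_form r W = Delta3 [^]\<^bsub>B3\<^esub> r)
        \<or> (odd r \<and> (\<exists>k. Delta_form r W = Delta3 [^]\<^bsub>B3\<^esub> r \<otimes>\<^bsub>B3\<^esub> gx k))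
        \<or> (even r \<and> (\<exists>k l. k \<noteq> l \<and>
              Delta_form r W = Delta3 [^]\<^bsub>B3\<^esub> r \<otimes>\<^bsub>B3\<^esub> gx k \<otimes>\<^bsub>B3\<^esub> gx l)))
      \<or> (int h + 1) mod 2 = r mod 2
      \<or> (\<forall>j\<in>{1..h}. 2 \<le> s j)"
    (is "_ \<longleftrightarrow> ?short \<or> ?cyclic")
proof -
  define w where "w = syllables i s [1..<h + 1]"
  have W: "W = ev w"
    unfolding W_eq syllable_prod_def w_def by (rule list_prod_syllables)
  have rigid: "rigid w"
    using normal_form by (simp add: W ev_MB3_plus_iff)
  have pos: "1 \<le> s j" if "1 \<le> j" "j \<le> h" for j
    using syllables that by (simp add: is_syllable_form_def)
  show ?thesis
  proof (cases "length w \<le> 2")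
    case True
    have "length [1..<h + 1] \<le> length w"
      unfolding w_def by (rule length_le_syllables) (use pos in auto)
    then consider "h = 0" | "h = 1" | "h = 2" using True by fastforce
    \<comment> \<open>All these short words are summit words, so the right-hand side has to hold
      outright: (ii) is vacuous for \<open>h = 0\<close>, while (i) covers even \<open>r\<close> for
      \<open>h = 1\<close> and odd \<open>r\<close> for \<open>h = 2\<close>.\<close>
    then have "?short \<or> ?cyclic"
    proof cases
      case 1
      then show ?thesis by simp
    next
      case 2
      show ?thesis
      proof (cases "even r \<or> 2 \<le> s 1")
        case True
        then show ?thesis using 2 by (auto simp: even_iff_mod_2_eq_zero)
      next
        case False
        then have "s 1 = 1" using pos[of 1] 2 by simp
        then have "W = gx (i 1)" by (simp add: W w_def 2 ev_single)
        then show ?thesis using False by (auto simp: Delta_form_def)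
      qed
    next
      case 3
      have upt: "[1..<h + 1] = [1, 2]" by (simp add: 3 upt_rec)
      have "s 1 = 1" "s 2 = 1"
        using True pos[of 1] pos[of 2] 3 unfolding w_def upt by simp_all
      then have "W = gx (i 1) \<cdot> gx (i 2)" unfolding W w_def upt by (simp add: ev_Cons)
      moreover have "i 1 \<noteq> i 2"
        using syllables 3 by (simp add: is_syllable_form_def numeral_2_eq_2)
      ultimately show ?thesis
        by (cases "even r") (auto simp: Delta_form_def times_assoc 3 odd_iff_mod_2_eq_one)
    qed
    then show ?thesis using summit_word_short[OF rigid True] by (simp add: W)
  next
    case False
    \<comment> \<open>Each form in (0) has exponent sum at most \<open>3 * r + 2\<close>, but here
      it is at least \<open>3 * r + 3\<close>.\<close>
    have "\<not> ?short"
      using False by (auto simp: Delta_form_def W dest!: arg_cong[where f = expsum])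
    moreover have "summit_word r W \<longleftrightarrow> ?cyclic"
      unfolding W using summit_word_iff_rigid[OF rigid, of r] False rigid
        rigid_cyclic_iff[OF syllables, of r] by (simp add: w_def)
    ultimately show ?thesis by blast
  qed
qed

end
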